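(* Let $\mathcal{S}=(X,\Sigma,\to,\leq,x_0)$ be a branch-effective branch-WSTS which is strictly branch-monotone and such that $\leq$ is a partial ordering. Then it is decidable whether the reachability set $\mathrm{Post}^*_{\mathcal{S}}(x_0)=\{y\in X\mid x_0\xrightarrow{*}y\}$ is finite (boundedness problem).
   Context: A quasi-ordered labelled transition system (OLTS) is a tuple $\mathcal{S}=(X,\Sigma,\to,\leq,x_0)$ where $X$ is a set of states, $\Sigma$ a finite alphabet, ${\to}\subseteq X\times\Sigma\times X$ a transition relation (written $x\xrightarrow{a}x'$), $\leq$ a quasi-ordering (reflexive, transitive) on $X$ and $x_0\in X$ the initial state. $x\xrightarrow{\sigma}x'$ for $\sigma\in\Sigma^*$ is defined as usual; $x\to x'$ means $x\xrightarrow{a}x'$ for some $a$, with reflexive-transitive closure $\xrightarrow{*}$ and transitive closure $\xrightarrow{+}$. $\mathrm{Post}(x)=\{y\mid x\to y\}$. A run is a finite or infinite sequence $x_0\to x_1\to x_2\cdots$ starting at $x_0$. The OLTS is: finitely branching if $\mathrm{Post}(x)$ is finite for all $x$; branch-wqo if for every run the set of states visited along it is well-quasi-ordered by $\leq$; branch-monotone if for all $x,x'\in X$ and $\sigma\in\Sigma^*$ with $x\xrightarrow{\sigma}x'$ and $x\leq x'$ there is $y$ with $x'\xrightarrow{\sigma}y$ and $x'\leq y$; strictly branch-monotone if the same holds with $x<x'$ and $x'<y$ (where $a<b$ means $a\leq b$ and $b\not\leq a$). A branch-WSTS is an OLTS that is finitely branching, branch-monotone and branch-wqo. It is effective if $\leq$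 and each relation $\xrightarrow{a}$ ($a\in\Sigma$) are decidable, and branch-effective if moreover $\mathrm{Post}(x)$ is a computable finite set for every $x\in X$. *)

theory Defs
  imports Main "HOL-Library.Nat_Bijection"
begin

section \<open>Ordered labelled transition systems\<close>

record ('x, 'a) olts =
  states :: "'x set"
  alphabet :: "'a set"
  transitions :: "('x \<times> 'a \<times> 'x) set"
  leq :: "'x rel"
  init :: 'x

definition is_olts :: "('x, 'a) olts \<Rightarrow> bool" where
  "is_olts S \<longleftrightarrow>
     finite (alphabet S) \<and>
     transitions S \<subseteq> states S \<times> alphabet S \<times> states S \<and>
     preorder_on (states S) (leq S) \<and>
     init S \<in> states S"

definition less_rel :: "('x, 'a) olts \<Rightarrow> 'x rel" where
  "less_rel S = {(x, y). (x, y) \<in> leq S \<and> (y, x) \<notin> leq S}"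

fun word_step :: "('x, 'a) olts \<Rightarrow> 'x \<Rightarrow> 'a list \<Rightarrow> 'x \<Rightarrow> bool" where
  "word_step S x [] y \<longleftrightarrow> x = y"
| "word_step S x (a # w) y \<longleftrightarrow> (\<exists>z. (x, a, z) \<in> transitions S \<and> word_step S z w y)"

definition step :: "('x, 'a) olts \<Rightarrow> 'x rel" where
  "step S = {(x, y). \<exists>a. (x, a, y) \<in> transitions S}"

definition Post :: "('x, 'a) olts \<Rightarrow> 'x \<Rightarrow> 'x set" where
  "Post S x = {y. (x, y) \<in> step S}"

definition Post_star :: "('x, 'a) olts \<Rightarrow> 'x \<Rightarrow> 'x set" where
  "Post_star S x = {y \<in> states S. (x, y) \<in> (step S)\<^sup>*}"

definition finite_run :: "('x, 'a) olts \<Rightarrow> 'x list \<Rightarrow> bool" where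
  "finite_run S xs \<longleftrightarrow>
     xs \<noteq> [] \<and> hd xs = init S \<and> successively (\<lambda>x y. (x, y) \<in> step S) xs"

definition infinite_run :: "('x, 'a) olts \<Rightarrow> (nat \<Rightarrow> 'x) \<Rightarrow> bool" where
  "infinite_run S f \<longleftrightarrow> f 0 = init S \<and> (\<forall>i. (f i, f (Suc i)) \<in> step S)"

definition wqo_on :: "'x set \<Rightarrow> 'x rel \<Rightarrow> bool" where
  "wqo_on A r \<longleftrightarrow>
     preorder_on A (Restr r A) \<and>
     (\<forall>f :: nat \<Rightarrow> 'x. (\<forall>i. f i \<in> A) \<longrightarrow> (\<exists>i j. i < j \<and> (f i, f j) \<in> r))"

definition finitely_branching :: "('x, 'a) olts \<Rightarrow> bool" where
  "finitely_branching S \<longleftrightarrow> (\<forall>x\<in>states S. finite (Post S x))"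

definition branch_wqo :: "('x, 'a) olts \<Rightarrow> bool" where
  "branch_wqo S \<longleftrightarrow>
     (\<forall>xs. finite_run S xs \<longrightarrow> wqo_on (set xs) (leq S)) \<and>
     (\<forall>f. infinite_run S f \<longrightarrow> wqo_on (range f) (leq S))"

definition branch_monotone :: "('x, 'a) olts \<Rightarrow> bool" where
  "branch_monotone S \<longleftrightarrow>
     (\<forall>x\<in>states S. \<forall>x'\<in>states S. \<forall>w\<in>lists (alphabet S).
        word_step S x w x' \<and> (x, x') \<in> leq S \<longrightarrow>
        (\<exists>y\<in>states S. word_step S x' w y \<and> (x', y) \<in> leq S))"

definition strictly_branch_monotone :: "('x, 'a) olts \<Rightarrow> bool" where
  "strictly_branch_monotone S \<longleftrightarrow>
     (\<forall>x\<in>states S. \<forall>x'\<in>states S. \<forall>w\<in>lists (alphabet S).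
        word_step S x w x' \<and> (x, x') \<in> less_rel S \<longrightarrow>
        (\<exists>y\<in>states S. word_step S x' w y \<and> (x', y) \<in> less_rel S))"

definition branch_WSTS :: "('x, 'a) olts \<Rightarrow> bool" where
  "branch_WSTS S \<longleftrightarrow>
     is_olts S \<and> finitely_branching S \<and> branch_monotone S \<and> branch_wqo S"


section \<open>Partial recursive functions\<close>

text \<open>
  Algorithms are Kleene's partial recursive functions. Programs carry no arity; a program
  denotes one partial function for each length of the argument list. The relation
  \<open>evals p xs v\<close> says that \<open>p\<close> halts on \<open>xs\<close> with output \<open>v\<close>.
\<close>

datatype recf =
    Zero
  | Succ
  | Proj nat
  | Comp recf "recf list"
  | PrimRec recf recf
  | Mu recf

inductive evals :: "recf \<Rightarrow> nat list \<Rightarrow> nat \<Rightarrow> bool" where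
  Zero: "evals Zero xs 0"
| Succ: "evals Succ [x] (Suc x)"
| Proj: "i < length xs \<Longrightarrow> evals (Proj i) xs (xs ! i)"
| Comp: "list_all2 (\<lambda>g y. evals g xs y) gs ys \<Longrightarrow> evals f ys v \<Longrightarrow> evals (Comp f gs) xs v"
| PrimRec_0: "evals g xs v \<Longrightarrow> evals (PrimRec g h) (0 # xs) v"
| PrimRec_Suc: "evals (PrimRec g h) (n # xs) u \<Longrightarrow> evals h (n # u # xs) v \<Longrightarrow>
    evals (PrimRec g h) (Suc n # xs) v"
| Mu: "evals f (n # xs) 0 \<Longrightarrow> (\<And>m. m < n \<Longrightarrow> \<exists>u>0. evals f (m # xs) u) \<Longrightarrow> evals (Mu f) xs n"

lemma evals_deterministic: "evals p xs v \<Longrightarrow> evals p xs w \<Longrightarrow> v = w"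
proof (induction arbitrary: w rule: evals.induct)
  case (Comp xs gs ys f v)
  from Comp.prems obtain zs where z: "list_all2 (\<lambda>g y. evals g xs y) gs zs" "evals f zs w"
    by (cases rule: evals.cases) auto
  have "ys = zs" using Comp.IH(1) z(1)
    by (auto simp: list_all2_conv_all_nth intro!: nth_equalityI)
  then show ?case using Comp.IH(2) z(2) by blast
next
  case (PrimRec_Suc g h n xs u v)
  from PrimRec_Suc.prems show ?case by (cases rule: evals.cases) (use PrimRec_Suc.IH in blast)+
next
  case (Mu f n xs)
  from Mu.prems show ?case
    by (cases rule: evals.cases) (metis Mu.IH less_numeral_extra(3) linorder_neqE_nat)
qed (erule evals.cases; auto)+

text \<open>Goedel numbering of programs.\<close>

primrec recf_code :: "recf \<Rightarrow> nat" where
  "recf_code Zero = prod_encode (0, 0)"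
| "recf_code Succ = prod_encode (1, 0)"
| "recf_code (Proj i) = prod_encode (2, i)"
| "recf_code (Comp f gs) = prod_encode (3, prod_encode (recf_code f, list_encode (map recf_code gs)))"
| "recf_code (PrimRec g h) = prod_encode (4, prod_encode (recf_code g, recf_code h))"
| "recf_code (Mu f) = prod_encode (5, recf_code f)"


section \<open>Effective presentations\<close>

text \<open>
  The finite description by which a system is handed to an algorithm: a program deciding the
  ordering, one program for each letter deciding the transition relation of that letter, a
  program computing \<^const>\<open>Post\<close>, and (the code of) the initial state.
\<close>

record presentation =
  leq_prog :: recf
  trans_progs :: "recf list"
  post_prog :: recf
  init_code :: nat

definition presentation_code :: "presentation \<Rightarrow> nat" where
  "presentation_code P =
     list_encode [recf_code (leq_prog P), list_encode (map recf_code (trans_progs P)),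
       recf_code (post_prog P), init_code P]"

text \<open>
  States are represented by natural numbers through \<open>enc\<close>, and the list \<open>letters\<close> enumerates
  the alphabet. Programs deciding a relation output 1 for true and 0 for false; they must halt
  on codes of states, and nothing is required of them on other inputs.
\<close>

definition effectively_presents ::
    "('x \<Rightarrow> nat) \<Rightarrow> 'a list \<Rightarrow> presentation \<Rightarrow> ('x, 'a) olts \<Rightarrow> bool" where
  "effectively_presents enc letters P S \<longleftrightarrow>
     inj_on enc (states S) \<and>
     distinct letters \<and> set letters = alphabet S \<and>
     init_code P = enc (init S) \<and>
     (\<forall>x\<in>states S. \<forall>y\<in>states S.
        evals (leq_prog P) [enc x, enc y] (if (x, y) \<in> leq S then 1 else 0)) \<and>
     length (trans_progs P) = length letters \<and>
     (\<forall>i<length letters. \<forall>x\<in>states S. \<forall>y\<in>states S.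
        evals (trans_progs P ! i) [enc x, enc y]
          (if (x, letters ! i, y) \<in> transitions S then 1 else 0))"

text \<open>
  For \<^const>\<open>Post\<close> to be a computable finite set, the program must output the whole set, as the
  code of a list of its elements (in any order, possibly with repetitions).
\<close>

definition branch_effectively_presents ::
    "('x \<Rightarrow> nat) \<Rightarrow> 'a list \<Rightarrow> presentation \<Rightarrow> ('x, 'a) olts \<Rightarrow> bool" where
  "branch_effectively_presents enc letters P S \<longleftrightarrow>
     effectively_presents enc letters P S \<and>
     (\<forall>x\<in>states S. \<exists>ys. set ys = Post S x \<and>
        evals (post_prog P) [enc x] (list_encode (map enc ys)))"

end

theory Submission
  imports Defs
begin

text \<open>
  Finiteness and infiniteness of the reachability set are both recursively enumerable in the
  presentation, so a parallel search for a witness of either decides between them. A finite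
  reachability set is witnessed by a finite set of states that contains the initial state and
  is closed under \<^const>\<open>Post\<close>. An infinite one is witnessed by reachable states \<open>x \<rightarrow>\<^sup>* y\<close>
  with \<open>x < y\<close>: strict monotonicity iterates such an increase, and conversely Koenig's lemma
  gives an infinite run without repetitions, on which the branch-wqo and antisymmetry produce
  an increase. That these searches are effective amounts to enumerating the graph of the
  universal function; membership in a finitary inductive definition with recursively
  enumerable rules is recursively enumerable, and \<^const>\<open>evals\<close> is of this kind on codes.
\<close>

section \<open>Computable functions\<close>

text \<open>As programs carry no arity, \<open>k\<close> restricts the claim to argument lists of
  one length. Only total functions are covered.\<close>

definition computes :: "nat \<Rightarrow> (nat list \<Rightarrow> nat) \<Rightarrow> bool" where
  "computes k f \<longleftrightarrow> (\<exists>p. \<forall>xs. length xs = k \<longrightarrow> evals p xs (f xs))"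

lemma computesI:
  assumes "\<And>xs. length xs = k \<Longrightarrow> evals p xs (f xs)"
  shows "computes k f"
  using assms unfolding computes_def by blast

lemma evals_Comp1: "evals g xs y \<Longrightarrow> evals f [y] v \<Longrightarrow> evals (Comp f [g]) xs v"
  by (rule evals.Comp[where ys = "[y]"]) auto

lemma evals_Comp2:
  "evals g xs y \<Longrightarrow> evals h xs z \<Longrightarrow> evals f [y, z] v \<Longrightarrow> evals (Comp f [g, h]) xs v"
  by (rule evals.Comp[where ys = "[y, z]"]) auto

lemma evals_Proj: "i < length xs \<Longrightarrow> xs ! i = v \<Longrightarrow> evals (Proj i) xs v"
  using evals.Proj by auto

lemma evals_PrimRec:
  assumes "evals g xs a" "\<And>m u. evals h (m # u # xs) (f m u)"
  shows "evals (PrimRec g h) (n # xs) (rec_nat a f n)"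
proof (induction n)
  case 0
  show ?case using assms(1) by (simp add: evals.PrimRec_0)
next
  case (Suc n)
  show ?case using evals.PrimRec_Suc[OF Suc assms(2)] by simp
qed

lemma evals_Mu:
  assumes "\<And>n. evals f (n # xs) (g n)" "g n0 = 0"
  shows "evals (Mu f) xs (LEAST n. g n = 0)"
proof (rule evals.Mu)
  show "evals f ((LEAST n. g n = 0) # xs) 0"
    using assms(1)[of "LEAST n. g n = 0"] LeastI[of "\<lambda>n. g n = 0", OF assms(2)] by simp
  show "\<exists>u>0. evals f (m # xs) u" if "m < (LEAST n. g n = 0)" for m
    using assms(1)[of m] not_less_Least[OF that] by blast
qed

lemma computes_Comp1:
  assumes "computes 1 f" "computes k g"
  shows "computes k (\<lambda>xs. f [g xs])"
proof -
  obtain p q where "\<And>xs. length xs = 1 \<Longrightarrow> evals p xs (f xs)"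
    "\<And>xs. length xs = k \<Longrightarrow> evals q xs (g xs)"
    using assms unfolding computes_def by blast
  then show ?thesis
    by (intro computesI[where p = "Comp p [q]"]) (metis evals_Comp1 length_Cons list.size(3) One_nat_def)
qed

lemma computes_Comp2:
  assumes "computes 2 f" "computes k g" "computes k h"
  shows "computes k (\<lambda>xs. f [g xs, h xs])"
proof -
  obtain p q r where "\<And>xs. length xs = 2 \<Longrightarrow> evals p xs (f xs)"
    "\<And>xs. length xs = k \<Longrightarrow> evals q xs (g xs)" "\<And>xs. length xs = k \<Longrightarrow> evals r xs (h xs)"
    using assms unfolding computes_def by blast
  then show ?thesis
    by (intro computesI[where p = "Comp p [q, r]"])
      (metis evals_Comp2 length_Cons list.size(3) One_nat_def Suc_1)
qed

lemma computes_Proj: "i < k \<Longrightarrow> computes k (\<lambda>xs. xs ! i)"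
  by (rule computesI[where p = "Proj i"]) (simp add: evals.Proj)

lemma computes_Zero: "computes k (\<lambda>xs. 0)"
  by (rule computesI[where p = Zero]) (rule evals.Zero)

lemma computes_Suc: "computes k f \<Longrightarrow> computes k (\<lambda>xs. Suc (f xs))"
proof -
  have "computes 1 (\<lambda>xs. Suc (hd xs))"
    by (rule computesI[where p = Succ]) (auto simp: length_Suc_conv intro: evals.Succ)
  then show "computes k f \<Longrightarrow> ?thesis"
    using computes_Comp1 by fastforce
qed

text \<open>Primitive recursion with one parameter, recursion argument first. One-place functions
  arise from it too, by filling the parameter with a dummy copy of the argument.\<close>

lemma computes_rec2:
  assumes "computes 1 g" "computes 3 h"
  shows "computes 2 (\<lambda>xs. rec_nat (g [xs ! 1]) (\<lambda>m u. h [m, u, xs ! 1]) (xs ! 0))"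
proof -
  obtain p q where *: "\<And>xs. length xs = 1 \<Longrightarrow> evals p xs (g xs)"
    "\<And>xs. length xs = 3 \<Longrightarrow> evals q xs (h xs)"
    using assms unfolding computes_def by blast
  show ?thesis
  proof (rule computesI[where p = "PrimRec p q"])
    fix xs :: "nat list"
    assume "length xs = 2"
    then obtain n y where xs: "xs = [n, y]"
      by (auto simp: length_Suc_conv numeral_2_eq_2)
    show "evals (PrimRec p q) xs
        (rec_nat (g [xs ! 1]) (\<lambda>m u. h [m, u, xs ! 1]) (xs ! 0))"
      unfolding xs using * by (simp add: evals_PrimRec)
  qed
qed

lemma computes_binI:
  assumes "computes 2 (\<lambda>xs. f (xs ! 0) (xs ! 1))" "computes k g" "computes k h"
  shows "computes k (\<lambda>xs. f (g xs) (h xs))"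
  using computes_Comp2[OF assms] by simp

section \<open>Arithmetic by primitive recursion\<close>

lemma computes_add:
  assumes "computes k f" "computes k g"
  shows "computes k (\<lambda>xs. f xs + g xs)"
proof (rule computes_binI[where f = "(+)", OF _ assms])
  have "rec_nat a (\<lambda>m u. Suc u) n = n + a" for a n :: nat
    by (induction n) auto
  then show "computes 2 (\<lambda>xs. xs ! 0 + xs ! 1)"
    using computes_rec2[OF computes_Proj[of 0] computes_Suc[OF computes_Proj[of 1]]] by simp
qed

lemma computes_mult:
  assumes "computes k f" "computes k g"
  shows "computes k (\<lambda>xs. f xs * g xs)"
proof (rule computes_binI[where f = "(*)", OF _ assms])
  have "rec_nat 0 (\<lambda>m u. u + a) n = n * a" for a n :: nat
    by (induction n) auto
  then show "computes 2 (\<lambda>xs. xs ! 0 * xs ! 1)"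
    using computes_rec2[OF computes_Zero
        computes_add[OF computes_Proj[of 1] computes_Proj[of 2]]] by simp
qed

lemma computes_pred:
  assumes "computes k f"
  shows "computes k (\<lambda>xs. f xs - 1)"
proof -
  have *: "rec_nat 0 (\<lambda>m u. m) n = n - 1" for n :: nat
    by (cases n) auto
  have "computes 2 (\<lambda>xs. xs ! 0 - 1)"
    using computes_rec2[OF computes_Zero computes_Proj[of 0]] by (simp add: *)
  from computes_Comp2[OF this assms assms] show ?thesis by simp
qed

lemma computes_diff:
  assumes "computes k f" "computes k g"
  shows "computes k (\<lambda>xs. f xs - g xs)"
proof -
  \<comment> \<open>Truncated subtraction iterates the predecessor. The recursion runs on the
    subtrahend, so the arguments are swapped back at the end.\<close>
  have *: "rec_nat a (\<lambda>m u. u - Suc 0) n = a - n" for a n :: nat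
    by (induction n) auto
  have "computes 2 (\<lambda>xs. xs ! 1 - xs ! 0)"
    using computes_rec2[OF computes_Proj[of 0] computes_pred[OF computes_Proj[of 1]]]
    by (simp add: *)
  from computes_Comp2[OF this assms(2,1)] show ?thesis by simp
qed

section \<open>The Cantor pairing function and its inverse\<close>

lemma computes_triangle:
  assumes "computes k f"
  shows "computes k (\<lambda>xs. triangle (f xs))"
proof -
  have *: "rec_nat 0 (\<lambda>m u. u + Suc m) n = triangle n" for n :: nat
    by (induction n) auto
  have "computes 2 (\<lambda>xs. triangle (xs ! 0))"
    using computes_rec2[OF computes_Zero
        computes_add[OF computes_Proj[of 1] computes_Suc[OF computes_Proj[of 0]]]]
    by (simp add: * del: add_Suc_right)
  from computes_Comp2[OF this assms assms] show ?thesis by simp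
qed

lemma computes_prod_encode:
  assumes "computes k f" "computes k g"
  shows "computes k (\<lambda>xs. prod_encode (f xs, g xs))"
  unfolding prod_encode_def by (auto intro!: computes_add computes_triangle assms)

text \<open>The index of the diagonal that holds \<open>z\<close> in Cantor's enumeration: the least
  \<open>s\<close> with \<open>z < triangle (Suc s)\<close>. A truncated difference equal to 0 is
  the form that a \<open>Mu\<close> search needs.\<close>

definition triangle_root :: "nat \<Rightarrow> nat" where
  "triangle_root z = (LEAST s. Suc z - triangle (Suc s) = 0)"

lemma triangle_mono: "m \<le> n \<Longrightarrow> triangle m \<le> triangle n"
  unfolding triangle_def by (intro div_le_mono mult_le_mono) auto

lemma triangle_root_prod_encode: "triangle_root (prod_encode (m, n)) = m + n"
  unfolding triangle_root_def
proof (rule Least_equality)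
  show "Suc (prod_encode (m, n)) - triangle (Suc (m + n)) = 0"
    by (simp add: prod_encode_def)
  fix s
  assume "Suc (prod_encode (m, n)) - triangle (Suc s) = 0"
  then have "triangle (m + n) < triangle (Suc s)"
    by (simp add: prod_encode_def)
  then show "m + n \<le> s"
    using triangle_mono[of "Suc s" "m + n"] by linarith
qed

lemma computes_triangle_root: "computes 1 (\<lambda>xs. triangle_root (xs ! 0))"
proof -
  have "computes 2 (\<lambda>xs. Suc (xs ! 1) - triangle (Suc (xs ! 0)))"
    by (intro computes_diff computes_Suc computes_triangle computes_Proj) auto
  then obtain p where p: "\<And>xs. length xs = 2 \<Longrightarrow>
      evals p xs (Suc (xs ! 1) - triangle (Suc (xs ! 0)))"
    unfolding computes_def by blast
  show ?thesis
  proof (rule computesI[where p = "Mu p"])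
    fix xs :: "nat list"
    assume "length xs = 1"
    then obtain z where xs: "xs = [z]" by (auto simp: length_Suc_conv)
    \<comment> \<open>\<open>s = z\<close> is a zero of the searched function, so the search
      halts.\<close>
    have "z \<le> triangle z" by (induction z) auto
    then have "Suc z - triangle (Suc z) = 0" by simp
    moreover have "evals p [s, z] (Suc z - triangle (Suc s))" for s
      using p[of "[s, z]"] by simp
    ultimately show "evals (Mu p) xs (triangle_root (xs ! 0))"
      unfolding xs triangle_root_def by (simp only: nth_Cons_0) (rule evals_Mu)
  qed
qed

lemma computes_unI:
  assumes "computes 1 (\<lambda>xs. f (xs ! 0))" "computes k g"
  shows "computes k (\<lambda>xs. f (g xs))"
  using computes_Comp1[OF assms] by simp

text \<open>\<open>prod_encode (m, n)\<close> is \<open>triangle (m + n) + m\<close>; once the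
  diagonal is known, subtraction recovers first \<open>m\<close>, then \<open>n\<close>.\<close>

lemma prod_decode_eq_triangle_root:
  shows "fst (prod_decode z) = z - triangle (triangle_root z)"
    and "snd (prod_decode z) = triangle_root z - (z - triangle (triangle_root z))"
proof -
  obtain m n where "z = prod_encode (m, n)"
    by (metis prod_decode_inverse surj_pair)
  moreover have "prod_encode (m, n) - triangle (m + n) = m"
    by (simp add: prod_encode_def)
  ultimately show "fst (prod_decode z) = z - triangle (triangle_root z)"
    and "snd (prod_decode z) = triangle_root z - (z - triangle (triangle_root z))"
    by (simp_all add: triangle_root_prod_encode)
qed

lemma computes_fst_prod_decode: "computes 1 (\<lambda>xs. fst (prod_decode (xs ! 0)))"
  unfolding prod_decode_eq_triangle_root
  by (intro computes_diff computes_triangle computes_triangle_root computes_Proj) auto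

lemma computes_snd_prod_decode: "computes 1 (\<lambda>xs. snd (prod_decode (xs ! 0)))"
  unfolding prod_decode_eq_triangle_root
  by (intro computes_diff computes_triangle computes_triangle_root computes_Proj) auto


section \<open>Coded types\<close>

text \<open>A bijection, not merely an injection: every number is a code, so a search through
  numbers meets only genuine objects and needs no validity test.\<close>

class coded =
  fixes code :: "'a \<Rightarrow> nat"
  assumes bij_code: "bij code"

lemma code_eq_iff [simp]: "code x = code y \<longleftrightarrow> x = (y :: 'a :: coded)"
  using bij_code by (auto simp: bij_def inj_def)

instantiation nat :: coded
begin
definition code_nat :: "nat \<Rightarrow> nat" where [simp]: "code_nat n = n"
instance by standard (simp add: bij_def inj_def surj_def)
end

instantiation prod :: (coded, coded) coded
begin
definition code_prod :: "'a \<times> 'b \<Rightarrow> nat" where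
  [simp]: "code_prod p = prod_encode (code (fst p), code (snd p))"
instance
proof
  have "surj (code :: 'a \<times> 'b \<Rightarrow> nat)"
  proof (rule surjI)
    fix n
    show "code (inv code (fst (prod_decode n)) :: 'a, inv code (snd (prod_decode n)) :: 'b) = n"
      by (simp add: surj_f_inv_f bij_code bij_is_surj)
  qed
  then show "bij (code :: 'a \<times> 'b \<Rightarrow> nat)"
    by (auto simp: bij_def inj_def prod_eq_iff)
qed
end

instantiation list :: (coded) coded
begin
definition code_list :: "'a list \<Rightarrow> nat" where
  "code_list xs = list_encode (map code xs)"
instance
proof
  have "(code :: 'a list \<Rightarrow> nat) = list_encode \<circ> map code"
    by (simp add: fun_eq_iff code_list_def)
  moreover have "bij (map (code :: 'a \<Rightarrow> nat))"
    using bij_code[where ?'a = 'a]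
    by (metis bij_def inj_mapI lists_UNIV lists_image top_empty_eq)
  ultimately show "bij (code :: 'a list \<Rightarrow> nat)"
    using bij_comp bij_list_encode by metis
qed
end

lemma code_Nil [simp]: "code [] = 0"
  by (simp add: code_list_def)

lemma code_Cons [simp]: "code (x # xs) = Suc (prod_encode (code x, code xs))"
  by (simp add: code_list_def)

definition computable :: "('a :: coded \<Rightarrow> 'b :: coded) \<Rightarrow> bool" where
  "computable f \<longleftrightarrow> (\<exists>p. \<forall>x. evals p [code x] (code (f x)))"

lemma computableI:
  assumes "\<And>x. evals p [code x] (code (f x))"
  shows "computable f"
  using assms unfolding computable_def by blast

lemma computable_by_code:
  assumes "computes 1 g" "\<And>x. code (f x) = g [code x]"
  shows "computable f"
proof -
  obtain p where "\<And>xs. length xs = 1 \<Longrightarrow> evals p xs (g xs)"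
    using assms(1) unfolding computes_def by blast
  then show ?thesis
    using assms(2) by (intro computableI[where p = p]) simp
qed

lemma computable_comp:
  assumes "computable f" "computable g"
  shows "computable (\<lambda>x. f (g x))"
proof -
  obtain p q where "\<And>x. evals p [code x] (code (f x))" "\<And>x. evals q [code x] (code (g x))"
    using assms unfolding computable_def by blast
  then show ?thesis
    by (intro computableI[where p = "Comp p [q]"] evals_Comp1)
qed

named_theorems comp_intros

lemma computable_id [comp_intros]: "computable (\<lambda>x. x)"
  by (rule computableI[where p = "Proj 0"]) (simp add: evals_Proj)

lemma computable_fst [comp_intros]:
  "computable f \<Longrightarrow> computable (\<lambda>x. fst (f x))"
  by (erule computable_comp[rotated], rule computable_by_code[OF computes_fst_prod_decode]) simp

lemma computable_snd [comp_intros]: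
  "computable f \<Longrightarrow> computable (\<lambda>x. snd (f x))"
  by (erule computable_comp[rotated], rule computable_by_code[OF computes_snd_prod_decode]) simp

lemma computable_code: "computable code"
  by (rule computableI[where p = "Proj 0"]) (simp add: evals_Proj)

lemma computable_bin:
  assumes "computes 2 (\<lambda>xs. h (xs ! 0) (xs ! 1))" "computable f" "computable g"
    and "\<And>x. code (i x) = h (code (f x)) (code (g x))"
  shows "computable i"
proof -
  obtain p q r where
    "\<And>x. evals p [code x] (code (f x))" "\<And>x. evals q [code x] (code (g x))"
    "\<And>xs. length xs = 2 \<Longrightarrow> evals r xs (h (xs ! 0) (xs ! 1))"
    using assms unfolding computable_def computes_def by blast
  moreover from this(3)[of "[_, _]"] have "evals r [a, b] (h a b)" for a b by simp
  ultimately show ?thesis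
    using assms(4) by (intro computableI[where p = "Comp r [p, q]"]) (metis evals_Comp2)
qed

lemma computable_Pair [comp_intros]:
  "computable f \<Longrightarrow> computable g \<Longrightarrow> computable (\<lambda>x. (f x, g x))"
  by (rule computable_bin[where h = "\<lambda>a b. prod_encode (a, b)"])
    (auto intro!: computes_prod_encode computes_Proj)

lemma computable_Cons [comp_intros]:
  "computable f \<Longrightarrow> computable g \<Longrightarrow> computable (\<lambda>x. f x # g x)"
  by (rule computable_bin[where h = "\<lambda>a b. Suc (prod_encode (a, b))"])
    (auto intro!: computes_Suc computes_prod_encode computes_Proj)

lemma computable_prod_encode [comp_intros]:
  assumes "computable f" "computable g"
  shows "computable (\<lambda>x. prod_encode (f x, g x))"
  by (rule computable_bin[where h = "\<lambda>a b. prod_encode (a, b)", OF _ assms])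
    (auto intro!: computes_prod_encode computes_Proj)

lemma computable_add [comp_intros]:
  assumes "computable f" "computable g"
  shows "computable (\<lambda>x. f x + g x :: nat)"
  by (rule computable_bin[where h = "(+)", OF _ assms])
    (auto intro!: computes_add computes_Proj)

lemma computable_mult [comp_intros]:
  assumes "computable f" "computable g"
  shows "computable (\<lambda>x. f x * g x :: nat)"
  by (rule computable_bin[where h = "(*)", OF _ assms])
    (auto intro!: computes_mult computes_Proj)

lemma computable_diff [comp_intros]:
  assumes "computable f" "computable g"
  shows "computable (\<lambda>x. f x - g x :: nat)"
  by (rule computable_bin[where h = "(-)", OF _ assms])
    (auto intro!: computes_diff computes_Proj)

lemma computable_const [comp_intros]: "computable (\<lambda>x. c)"
proof (rule computable_by_code)
  have "computes 1 (\<lambda>xs. n)" for n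
    by (induction n) (auto intro: computes_Zero computes_Suc)
  then show "computes 1 (\<lambda>xs. code c)" .
qed simp

lemma computable_Suc [comp_intros]: "computable f \<Longrightarrow> computable (\<lambda>x. Suc (f x))"
  by (erule computable_comp[rotated], rule computable_by_code[OF computes_Suc[OF computes_Proj]])
    auto

lemma computable_list_encode [comp_intros]:
  "computable f \<Longrightarrow> computable (\<lambda>x. list_encode (f x))"
  using computable_comp[OF computable_code, of f]
  by (simp add: code_list_def map_idI)

lemma computable_tl [comp_intros]:
  assumes "computable f"
  shows "computable (\<lambda>x. tl (f x))"
proof (rule computable_comp[OF computable_by_code assms])
  show "computes 1 (\<lambda>xs. snd (prod_decode (xs ! 0 - 1)))"
    by (intro computes_unI[OF computes_snd_prod_decode] computes_pred computes_Proj) auto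
  \<comment> \<open>\<open>[]\<close> has code 0 and the predecessor of 0 is 0, so the empty case
    depends on how 0 decodes.\<close>
  have "snd (prod_decode 0) = 0"
    by (simp add: prod_decode_def prod_decode_aux.simps)
  then show "code (tl xs) = snd (prod_decode ([code xs] ! 0 - 1))" for xs :: "'b list"
    by (cases xs) auto
qed

definition hd0 :: "nat list \<Rightarrow> nat" where
  "hd0 xs = (case xs of [] \<Rightarrow> 0 | x # _ \<Rightarrow> x)"

lemma computable_hd0 [comp_intros]:
  assumes "computable f"
  shows "computable (\<lambda>x. hd0 (f x))"
proof (rule computable_comp[OF computable_by_code assms])
  show "computes 1 (\<lambda>xs. fst (prod_decode (xs ! 0 - 1)))"
    by (intro computes_unI[OF computes_fst_prod_decode] computes_pred computes_Proj) auto
  have "fst (prod_decode 0) = 0"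
    by (simp add: prod_decode_def prod_decode_aux.simps)
  then show "code (hd0 xs) = fst (prod_decode ([code xs] ! 0 - 1))" for xs
    by (cases xs) (auto simp: hd0_def)
qed

text \<open>The environment \<open>e\<close> is the parameter of the recursion. The step is taken
  uncurried, as a function of \<open>((e, n), u)\<close>, so that its computability concerns a
  single coded argument.\<close>

lemma computable_rec_nat [comp_intros]:
  fixes g :: "'a :: coded \<Rightarrow> 'b :: coded"
  assumes "computable g" "computable (\<lambda>p. h (fst (fst p)) (snd (fst p)) (snd p))" "computable k"
  shows "computable (\<lambda>e. rec_nat (g e) (h e) (k e))"
proof -
  obtain p q r where p: "\<And>x. evals p [code x] (code (g x))"
    and q: "\<And>x. evals q [code x] (code (h (fst (fst x)) (snd (fst x)) (snd x)))"
    and r: "\<And>x. evals r [code x] (code (k x))"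
    using assms unfolding computable_def by blast
  \<comment> \<open>\<open>PrimRec\<close> hands its step the list \<open>[n, u, e]\<close>;
    \<open>t\<close> repacks it as the code of \<open>((e, n), u)\<close>.\<close>
  have "computes 3 (\<lambda>xs. prod_encode (prod_encode (xs ! 2, xs ! 0), xs ! 1))"
    by (intro computes_prod_encode computes_Proj) auto
  then obtain t where
    t: "\<And>xs. length xs = 3 \<Longrightarrow> evals t xs (prod_encode (prod_encode (xs ! 2, xs ! 0), xs ! 1))"
    unfolding computes_def by blast
  have step: "evals (Comp q [t]) [n, code u, code e] (code (h e n u))" for n u e
    by (rule evals_Comp1[OF t, of "[n, code u, code e]"])
      (use q[of "((e, n), u)"] in \<open>simp_all add: numeral_2_eq_2\<close>)
  have main: "evals (PrimRec p (Comp q [t])) [n, code e] (code (rec_nat (g e) (h e) n))" for n e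
  proof (induction n)
    case 0
    show ?case using p by (simp add: evals.PrimRec_0)
  next
    case (Suc n)
    show ?case using evals.PrimRec_Suc[OF Suc step] by simp
  qed
  show ?thesis
    by (rule computableI[where p = "Comp (PrimRec p (Comp q [t])) [r, Proj 0]"])
      (rule evals_Comp2, rule r, auto simp: evals_Proj intro: main)
qed

lemma computable_drop [comp_intros]:
  assumes "computable k" "computable f"
  shows "computable (\<lambda>x. drop (k x) (f x))"
proof -
  have *: "drop n xs = rec_nat xs (\<lambda>_. tl) n" for n and xs :: "'c list"
    by (induction n) (auto simp: drop_Suc simp flip: tl_drop)
  show ?thesis unfolding * by (intro comp_intros assms)
qed


section \<open>Recursively enumerable predicates\<close>

definition decidable :: "('a :: coded \<Rightarrow> bool) \<Rightarrow> bool" where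
  "decidable P \<longleftrightarrow> computable (\<lambda>x. of_bool (P x) :: nat)"

lemma decidable_comp:
  "decidable P \<Longrightarrow> computable f \<Longrightarrow> decidable (\<lambda>x. P (f x))"
  unfolding decidable_def by (rule computable_comp)

lemma decidable_conj:
  assumes "decidable P" "decidable Q"
  shows "decidable (\<lambda>x. P x \<and> Q x)"
  using computable_mult assms unfolding decidable_def of_bool_conj by blast

lemma decidable_not:
  assumes "decidable P"
  shows "decidable (\<lambda>x. \<not> P x)"
proof -
  have "computable (\<lambda>x. 1 - of_bool (P x) :: nat)"
    by (intro comp_intros assms[unfolded decidable_def])
  moreover have "(1 - of_bool b :: nat) = of_bool (\<not> b)" for b
    by (cases b) auto
  ultimately show ?thesis unfolding decidable_def by simp
qed

lemma decidable_disj: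
  assumes "decidable P" "decidable Q"
  shows "decidable (\<lambda>x. P x \<or> Q x)"
  using decidable_not[OF decidable_conj[OF decidable_not decidable_not]] assms by fastforce

lemma decidable_eq:
  assumes "computable f" "computable g"
  shows "decidable (\<lambda>x. f x = g x)"
proof -
  have "computable (\<lambda>x. 1 - ((code (f x) - code (g x)) + (code (g x) - code (f x))))"
    by (intro comp_intros computable_comp[OF computable_code] assms)
  \<comment> \<open>Both truncated differences vanish only if the codes agree; injectivity of
    \<open>code\<close> carries this to the values.\<close>
  moreover have "1 - ((code (f x) - code (g x)) + (code (g x) - code (f x)))
      = of_bool (f x = g x)" for x
    by (cases "code (f x)" "code (g x)" rule: linorder_cases) (auto dest: less_imp_neq)
  ultimately show ?thesis unfolding decidable_def by simp
qed

lemma decidable_all_less: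
  assumes "computable k" "decidable (\<lambda>p. P (fst p) (snd p))"
  shows "decidable (\<lambda>x. \<forall>i < (k x :: nat). P x i)"
proof -
  \<comment> \<open>A bounded universal quantifier is a product of characteristic values, computed
    by recursion on the bound.\<close>
  have eq: "of_bool (\<forall>i < n. P x i) = rec_nat (1 :: nat) (\<lambda>n u. u * of_bool (P x n)) n" for x n
  proof (induction n)
    case (Suc n)
    have "(\<forall>i < Suc n. P x i) \<longleftrightarrow> (\<forall>i < n. P x i) \<and> P x n"
      by (auto simp: less_Suc_eq)
    with Suc show ?case by (simp only: of_bool_conj old.nat.simps(7))
  qed simp
  have "computable (\<lambda>p. of_bool (P (fst (fst p)) (snd (fst p))) :: nat)"
    using decidable_comp[OF assms(2) computable_fst[OF computable_id]]
    unfolding decidable_def .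
  then show ?thesis unfolding decidable_def eq
    by (intro comp_intros assms(1))
qed

text \<open>Recursive enumerability as projection of a decidable relation; the number
  \<open>w\<close> is the certificate that a search looks for.\<close>

definition re :: "('a :: coded \<Rightarrow> bool) \<Rightarrow> bool" where
  "re P \<longleftrightarrow> (\<exists>D. decidable D \<and> (\<forall>x. P x \<longleftrightarrow> (\<exists>w :: nat. D (x, w))))"

lemma reE:
  assumes "re P"
  obtains D where "decidable D" "\<And>x. P x \<longleftrightarrow> (\<exists>w :: nat. D (x, w))"
  using assms unfolding re_def by blast

text \<open>Certificates may have any coded type: decoding is surjective and, seen on codes, is the
  identity, so numbers can replace them and the test stays decidable.\<close>

lemma reI:
  fixes D :: "'a :: coded \<times> 'w :: coded \<Rightarrow> bool"
  assumes "decidable D" "\<And>x. P x \<longleftrightarrow> (\<exists>w. D (x, w))"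
  shows "re P"
proof -
  have inv: "code (inv code n :: 'w) = n" for n
    by (simp add: surj_f_inv_f bij_code bij_is_surj)
  then have "computable (inv code :: nat \<Rightarrow> 'w)"
    by (intro computableI[where p = "Proj 0"]) (simp add: evals_Proj)
  then have "computable (\<lambda>p :: 'a \<times> nat. inv code (snd p) :: 'w)"
    using computable_comp computable_snd computable_id by blast
  then have "decidable (\<lambda>p. D (fst p, inv code (snd p)))"
    by (intro decidable_comp[OF assms(1)] comp_intros)
  moreover have "P x \<longleftrightarrow> (\<exists>n. D (x, inv code n))" for x
    unfolding assms(2) using inv by (metis code_eq_iff)
  ultimately show ?thesis unfolding re_def by fastforce
qed

named_theorems re_intros

lemma re_decidable: "decidable P \<Longrightarrow> re P"
  by (rule reI[where D = "\<lambda>p :: _ \<times> nat. P (fst p)"])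
    (auto intro!: decidable_comp[where P = P] comp_intros)

lemma re_eq [re_intros]: "computable f \<Longrightarrow> computable g \<Longrightarrow> re (\<lambda>x. f x = g x)"
  by (intro re_decidable decidable_eq)

lemma re_comp:
  assumes "re P" "computable f"
  shows "re (\<lambda>x. P (f x))"
proof -
  obtain D where D: "decidable D" "\<And>x. P x \<longleftrightarrow> (\<exists>w :: nat. D (x, w))"
    using assms(1) by (elim reE) blast
  have "computable (\<lambda>p :: _ \<times> nat. f (fst p))"
    using computable_comp[OF assms(2) computable_fst[OF computable_id]] .
  then have "decidable (\<lambda>p. D (f (fst p), snd p))"
    by (intro decidable_comp[OF D(1)] comp_intros)
  then show ?thesis by (rule reI) (simp add: D(2))
qed

lemma re_conj [re_intros]:
  assumes "re P" "re Q"
  shows "re (\<lambda>x. P x \<and> Q x)"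
proof -
  obtain C D where "decidable C" "\<And>x. P x \<longleftrightarrow> (\<exists>w :: nat. C (x, w))"
    and "decidable D" "\<And>x. Q x \<longleftrightarrow> (\<exists>w :: nat. D (x, w))"
    using assms by (elim reE) blast
  then show ?thesis
    by (intro reI[where D = "\<lambda>p. C (fst p, fst (snd p)) \<and> D (fst p, snd (snd p))"])
      (auto intro!: decidable_conj decidable_comp[where P = C] decidable_comp[where P = D]
        comp_intros)
qed

lemma re_disj [re_intros]:
  assumes "re P" "re Q"
  shows "re (\<lambda>x. P x \<or> Q x)"
proof -
  obtain C D where "decidable C" "\<And>x. P x \<longleftrightarrow> (\<exists>w :: nat. C (x, w))"
    and "decidable D" "\<And>x. Q x \<longleftrightarrow> (\<exists>w :: nat. D (x, w))"
    using assms by (elim reE) blast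
  then show ?thesis
    by (intro reI[where D = "\<lambda>p. C p \<or> D p"]) (auto intro!: decidable_disj)
qed

lemma re_ex [re_intros]:
  fixes P :: "'a :: coded \<Rightarrow> 'b :: coded \<Rightarrow> bool"
  assumes "re (\<lambda>p. P (fst p) (snd p))"
  shows "re (\<lambda>x. \<exists>y. P x y)"
proof -
  obtain D where D: "decidable D" "\<And>p. P (fst p) (snd p) \<longleftrightarrow> (\<exists>w :: nat. D (p, w))"
    using assms by (elim reE) blast
  have "decidable (\<lambda>p. D ((fst p, fst (snd p)), snd (snd p)))"
    by (intro decidable_comp[OF D(1)] comp_intros)
  then show ?thesis
    by (rule reI) (use D(2)[of "(_, _)"] in auto)
qed

text \<open>One list of numbers serves as a simultaneous choice of witnesses for all indices.\<close>

lemma re_all_less [re_intros]: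
  assumes "computable k" "re (\<lambda>p. P (fst p) (snd p))"
  shows "re (\<lambda>x. \<forall>i < (k x :: nat). P x i)"
proof -
  obtain D where D: "decidable D" "\<And>p. P (fst p) (snd p) \<longleftrightarrow> (\<exists>w :: nat. D (p, w))"
    using assms(2) by (elim reE) blast
  have "decidable (\<lambda>q. D ((fst (fst q), snd q), hd0 (drop (snd q) (snd (fst q)))))"
    by (intro decidable_comp[OF D(1)] comp_intros)
  moreover have "computable (\<lambda>p :: 'a \<times> nat list. k (fst p))"
    using computable_comp[OF assms(1) computable_fst[OF computable_id]] .
  ultimately have dec: "decidable (\<lambda>p. \<forall>i < k (fst p). D ((fst p, i), hd0 (drop i (snd p))))"
    by (intro decidable_all_less)
  have "(\<forall>i < n. P x i) \<longleftrightarrow> (\<exists>ws. \<forall>i < n. D ((x, i), hd0 (drop i ws)))" for n x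
  proof
    assume "\<forall>i < n. P x i"
    then obtain w where w: "\<And>i. i < n \<Longrightarrow> D ((x, i), w i)"
      using D(2)[of "(x, _)"] by simp metis
    show "\<exists>ws. \<forall>i < n. D ((x, i), hd0 (drop i ws))"
    proof (intro exI allI impI)
      fix i
      assume "i < n"
      then have "drop i (map w [0..<n]) = w i # drop (Suc i) (map w [0..<n])"
        by (simp flip: Cons_nth_drop_Suc)
      with w[OF \<open>i < n\<close>] show "D ((x, i), hd0 (drop i (map w [0..<n])))"
        by (simp add: hd0_def)
    qed
  qed (use D(2)[of "(x, _)"] in auto)
  with dec show ?thesis by (intro reI[OF dec]) simp
qed

text \<open>A suffix \<open>drop i ys\<close> starts with the element. This leaves only existential
  quantifiers and an equation between computable terms.\<close>

lemma re_mem [re_intros]: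
  assumes "computable f" "computable g"
  shows "re (\<lambda>x. f x \<in> set (g x))"
proof -
  have "y \<in> set ys \<longleftrightarrow> (\<exists>i zs. drop i ys = y # zs)" for y :: 'b and ys
    by (metis Cons_nth_drop_Suc in_set_conv_nth in_set_dropD list.set_intros(1))
  moreover have "re (\<lambda>x. \<exists>i zs. drop i (g x) = f x # zs)"
    by (intro re_intros comp_intros computable_comp[OF assms(1)] computable_comp[OF assms(2)])
  ultimately show ?thesis by simp
qed

lemma re_comp3:
  assumes "re (\<lambda>p. P (fst (fst p)) (snd (fst p)) (snd p))"
    and "computable f" "computable g" "computable h"
  shows "re (\<lambda>x. P (f x) (g x) (h x))"
  using re_comp[OF assms(1) computable_Pair[OF computable_Pair[OF assms(2,3)] assms(4)]] by simp

text \<open>The lists are read position by position through \<open>drop\<close>. The bound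
  \<open>n\<close> is forced to be the length of both, as the suffixes are empty at \<open>n\<close>
  and nonempty below.\<close>

lemma re_list_all2 [re_intros]:
  fixes P :: "'a :: coded \<Rightarrow> 'b :: coded \<Rightarrow> 'c :: coded \<Rightarrow> bool"
  assumes "re (\<lambda>p. P (fst (fst p)) (snd (fst p)) (snd p))" "computable f" "computable g"
  shows "re (\<lambda>x. list_all2 (P x) (f x) (g x))"
proof -
  have eq: "list_all2 R ys zs \<longleftrightarrow> (\<exists>n. drop n ys = [] \<and> drop n zs = [] \<and>
      (\<forall>i < n. \<exists>y ys' z zs'. drop i ys = y # ys' \<and> drop i zs = z # zs' \<and> R y z))"
    (is "?L \<longleftrightarrow> (\<exists>n. ?R n)") for R :: "'b \<Rightarrow> 'c \<Rightarrow> bool" and ys zs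
  proof
    assume ?L
    then have "?R (length ys)"
      by (auto simp: list_all2_conv_all_nth simp flip: Cons_nth_drop_Suc)
    then show "\<exists>n. ?R n" by blast
  next
    assume "\<exists>n. ?R n"
    then obtain n where n: "?R n" ..
    have nth: "i < length ys \<and> i < length zs \<and> R (ys ! i) (zs ! i)" if "i < n" for i
      using n that by (metis drop_eq_Nil list.distinct(1) not_le nth_via_drop)
    have "length ys = n" "length zs = n"
      using n nth by (metis drop_eq_Nil le_neq_implies_less less_irrefl)+
    with nth show ?L by (simp add: list_all2_conv_all_nth)
  qed
  show ?thesis unfolding eq
    by (intro re_intros comp_intros re_comp3[OF assms(1)] computable_comp[OF assms(2)] computable_comp[OF assms(3)])
qed

lemma re_Ball [re_intros]:
  fixes P :: "'a :: coded \<Rightarrow> 'b :: coded \<Rightarrow> bool"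
  assumes "re (\<lambda>p. P (fst p) (snd p))" "computable f"
  shows "re (\<lambda>x. \<forall>y\<in>set (f x). P x y)"
proof -
  have "re (\<lambda>x. list_all2 (\<lambda>y _. P x y) (f x) (f x))"
    using re_comp[OF assms(1), where f = "\<lambda>p :: ('a \<times> 'b) \<times> 'b. fst p"] assms(2)
    by (intro re_intros) (simp_all add: comp_intros)
  then show ?thesis by (simp add: list_all2_same)
qed


section \<open>Derivability from recursively enumerable finitary rules\<close>

inductive deriv :: "('a \<times> 'a list \<Rightarrow> bool) \<Rightarrow> 'a \<Rightarrow> bool" for J where
  derivI: "J (x, prems) \<Longrightarrow> (\<And>y. y \<in> set prems \<Longrightarrow> deriv J y) \<Longrightarrow> deriv J x"

text \<open>A derivation is written backwards, each entry being justified by later ones.\<close>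

primrec proof_list :: "('a \<times> 'a list \<Rightarrow> bool) \<Rightarrow> 'a list \<Rightarrow> bool" where
  "proof_list J [] \<longleftrightarrow> True"
| "proof_list J (y # ys) \<longleftrightarrow> (\<exists>prems. J (y, prems) \<and> set prems \<subseteq> set ys) \<and> proof_list J ys"

lemma proof_list_append: "proof_list J xs \<Longrightarrow> proof_list J ys \<Longrightarrow> proof_list J (xs @ ys)"
  by (induction xs) auto

lemma proof_list_sound: "proof_list J L \<Longrightarrow> x \<in> set L \<Longrightarrow> deriv J x"
proof (induction L arbitrary: x)
  case (Cons y ys)
  from Cons.prems(1) obtain prems where "J (y, prems)" "set prems \<subseteq> set ys" by auto
  with Cons.IH Cons.prems(1) have "deriv J y" by (intro derivI[of J y prems]) auto
  with Cons show ?case by auto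
qed simp

lemma proof_list_complete:
  assumes "deriv J x"
  shows "\<exists>L. proof_list J (x # L)"
  using assms
proof induction
  case (derivI x prems)
  \<comment> \<open>The derivations of the premises are concatenated one by one; every entry stays
    justified, since concatenation takes no later entry away.\<close>
  have "\<exists>L. proof_list J L \<and> set ys \<subseteq> set L" if "set ys \<subseteq> set prems" for ys
    using that
  proof (induction ys)
    case (Cons y ys)
    then obtain L where L: "proof_list J L" "set ys \<subseteq> set L" by auto
    obtain M where "proof_list J (y # M)" using derivI.IH[of y] Cons.prems by auto
    from proof_list_append[OF this L(1)] L(2) show ?case
      by (intro exI[of _ "(y # M) @ L"]) auto
  qed (auto intro: exI[of _ "[]"])
  from this[of prems] derivI.hyps show ?case by auto
qed

text \<open>The recursion on the list is traded for a bounded quantifier over positions, for which a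
  closure rule of \<open>re\<close> exists.\<close>

lemma proof_list_iff:
  "proof_list J L \<longleftrightarrow> (\<exists>n. drop n L = [] \<and> (\<forall>i < n. \<exists>y ys prems.
    drop i L = y # ys \<and> J (y, prems) \<and> (\<forall>z\<in>set prems. z \<in> set ys)))"
  (is "_ \<longleftrightarrow> (\<exists>n. ?R n L)")
proof
  assume "proof_list J L"
  then have "?R (length L) L"
  proof (induction L)
    case (Cons y ys)
    show ?case
    proof (intro conjI allI impI)
      fix i
      assume "i < length (y # ys)"
      with Cons show "\<exists>z zs prems. drop i (y # ys) = z # zs \<and> J (z, prems) \<and>
          (\<forall>u\<in>set prems. u \<in> set zs)"
        by (cases i) auto
    qed simp
  qed simp
  then show "\<exists>n. ?R n L" by blast
next
  assume "\<exists>n. ?R n L"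
  then obtain n where "?R n L" ..
  then show "proof_list J L"
  proof (induction L arbitrary: n)
    case (Cons y ys)
    then obtain m where m: "n = Suc m" by (cases n) auto
    \<comment> \<open>Index \<open>i\<close> of \<open>ys\<close> is index \<open>Suc i\<close> of
      \<open>y # ys\<close>.\<close>
    have "?R m ys" using Cons.prems unfolding m by fastforce
    with Cons.IH have "proof_list J ys" .
    moreover have "\<exists>prems. J (y, prems) \<and> (\<forall>z\<in>set prems. z \<in> set ys)"
      using Cons.prems unfolding m by force
    ultimately show ?case by auto
  qed simp
qed

text \<open>The certificate is a whole derivation in one list. It suffices that \<open>J\<close> is
  enumerable, because bounded quantification over the entries preserves \<open>re\<close>.\<close>

lemma re_deriv:
  assumes "re J"
  shows "re (deriv J)"
proof -
  have eq: "deriv J = (\<lambda>x. \<exists>L. proof_list J (x # L))"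
    using proof_list_sound proof_list_complete by (metis list.set_intros(1))
  show ?thesis
    unfolding eq proof_list_iff by (intro re_intros comp_intros re_comp[OF assms])
qed


text \<open>Closure as an inference system: the shorter path is a premise, the last edge a side
  condition. The parameter \<open>a\<close> is carried unchanged, so one system serves all relations
  \<open>P a\<close>.\<close>

definition closure_rule :: "('a \<Rightarrow> 'b \<Rightarrow> 'b \<Rightarrow> bool) \<Rightarrow> ('a \<times> 'b \<times> 'b) \<times> ('a \<times> 'b \<times> 'b) list \<Rightarrow> bool"
  where "closure_rule P e \<longleftrightarrow> (\<exists>a x y prems. e = ((a, x, y), prems) \<and>
    (x = y \<or> (\<exists>z. (a, x, z) \<in> set prems \<and> P a z y)))"

lemma deriv_closure_rule: "deriv (closure_rule P) (a, x, y) \<longleftrightarrow> (P a)\<^sup>*\<^sup>* x y"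
proof
  show "deriv (closure_rule P) (a, x, y) \<Longrightarrow> (P a)\<^sup>*\<^sup>* x y"
  proof (induction "(a, x, y)" arbitrary: y rule: deriv.induct)
    case (derivI prems y)
    from derivI.hyps(1) consider "x = y" | z where "(a, x, z) \<in> set prems" "P a z y"
      unfolding closure_rule_def by blast
    then show ?case
      by cases (use derivI.hyps(3) in \<open>auto intro: rtranclp.rtrancl_into_rtrancl\<close>)
  qed
  show "(P a)\<^sup>*\<^sup>* x y \<Longrightarrow> deriv (closure_rule P) (a, x, y)"
  proof (induction rule: rtranclp_induct)
    case base
    show ?case by (rule derivI[where prems = "[]"]) (auto simp: closure_rule_def)
  next
    case (step y z)
    then show ?case
      by - (rule derivI[where prems = "[(a, x, y)]"], auto simp: closure_rule_def)
  qed
qed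

lemma re_rtranclp [re_intros]:
  fixes P :: "'a :: coded \<Rightarrow> 'b :: coded \<Rightarrow> 'b \<Rightarrow> bool"
  assumes "re (\<lambda>p. P (fst (fst p)) (snd (fst p)) (snd p))"
    and "computable f" "computable g" "computable h"
  shows "re (\<lambda>x. (P (f x))\<^sup>*\<^sup>* (g x) (h x))"
proof -
  have "re (closure_rule P)"
    unfolding closure_rule_def by (intro re_intros comp_intros re_comp3[OF assms(1)])
  from re_deriv[OF this] show ?thesis
    unfolding deriv_closure_rule[symmetric]
    by (rule re_comp) (intro comp_intros assms)
qed


section \<open>Evaluation of coded programs\<close>

text \<open>The rules for \<^const>\<open>evals\<close>, as inferences between judgements \<open>(program code, arguments, value)\<close>.\<close>

definition eval_rule :: "(nat \<times> nat list \<times> nat) \<times> (nat \<times> nat list \<times> nat) list \<Rightarrow> bool" where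
  "eval_rule e \<longleftrightarrow> (\<exists>p xs v prems. e = ((p, xs, v), prems) \<and>
    (p = prod_encode (0, 0) \<and> v = 0 \<or>
     (\<exists>x. p = prod_encode (1, 0) \<and> xs = [x] \<and> v = Suc x) \<or>
     (\<exists>i zs. p = prod_encode (2, i) \<and> drop i xs = v # zs) \<or>
     (\<exists>f gs ys. p = prod_encode (3, prod_encode (f, list_encode gs)) \<and>
       list_all2 (\<lambda>g y. (g, xs, y) \<in> set prems) gs ys \<and> (f, ys, v) \<in> set prems) \<or>
     (\<exists>g h zs. p = prod_encode (4, prod_encode (g, h)) \<and> xs = 0 # zs \<and>
       (g, zs, v) \<in> set prems) \<or>
     (\<exists>g h n u zs. p = prod_encode (4, prod_encode (g, h)) \<and> xs = Suc n # zs \<and>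
       (p, n # zs, u) \<in> set prems \<and> (h, n # u # zs, v) \<in> set prems) \<or>
     (\<exists>f. p = prod_encode (5, f) \<and> (f, v # xs, 0) \<in> set prems \<and>
       (\<forall>m < v. \<exists>u. (f, m # xs, Suc u) \<in> set prems))))"

text \<open>The rules use only existential and bounded quantifiers, equations, membership and
  \<open>list_all2\<close>, so the closure rules apply clause by clause.\<close>

lemma re_eval_rule: "re eval_rule"
  unfolding eval_rule_def by (intro re_intros comp_intros)

definition evals_code :: "nat \<Rightarrow> nat list \<Rightarrow> nat \<Rightarrow> bool" where
  "evals_code p xs v \<longleftrightarrow> deriv eval_rule (p, xs, v)"

lemma re_evals_code [re_intros]:
  assumes "computable f" "computable g" "computable h"
  shows "re (\<lambda>x. evals_code (f x) (g x) (h x))"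
  unfolding evals_code_def
  by (intro re_comp[OF re_deriv[OF re_eval_rule]] comp_intros assms)

text \<open>Derivations may mention numbers that code no program, so the induction is confined to
  judgements about some \<open>recf_code q\<close>. Injectivity of the pairing selects the clause
  that fits \<open>q\<close> and makes the premises it uses concern \<open>q\<close> or its
  subprograms.\<close>

lemma evals_code_sound:
  assumes "deriv eval_rule (recf_code q, xs, v)"
  shows "evals q xs v"
  using assms
proof (induction "(recf_code q, xs, v)" arbitrary: q xs v)
  case (derivI prems)
  have IH: "evals q ys w" if "(recf_code q, ys, w) \<in> set prems" for q ys w
    using derivI.hyps(3)[OF that] by simp
  show ?case
  proof (cases q)
    case Zero
    then show ?thesis using derivI.hyps(1) by (auto simp: eval_rule_def intro: evals.Zero)
  next
    case Succ
    then show ?thesis using derivI.hyps(1) by (auto simp: eval_rule_def intro: evals.Succ)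
  next
    case (Proj i)
    then obtain zs where zs: "drop i xs = v # zs"
      using derivI.hyps(1) by (auto simp: eval_rule_def)
    then have "i < length xs" by (metis drop_eq_Nil list.distinct(1) not_le)
    with zs show ?thesis unfolding Proj by (intro evals_Proj) (auto intro: nth_via_drop)
  next
    case (Comp f gs)
    then obtain ys where "list_all2 (\<lambda>g y. (g, xs, y) \<in> set prems) (map recf_code gs) ys"
      "(recf_code f, ys, v) \<in> set prems"
      using derivI.hyps(1) by (auto simp: eval_rule_def list_encode_eq)
    then show ?thesis unfolding Comp
      by (intro evals.Comp[where ys = ys]) (auto simp: list_all2_conv_all_nth intro: IH)
  next
    case (PrimRec g h)
    then consider zs where "xs = 0 # zs" "(recf_code g, zs, v) \<in> set prems"
      | n u zs where "xs = Suc n # zs" "(recf_code q, n # zs, u) \<in> set prems"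
        "(recf_code h, n # u # zs, v) \<in> set prems"
      using derivI.hyps(1) by (auto simp: eval_rule_def)
    then show ?thesis
    proof cases
      case 1
      then show ?thesis using IH PrimRec by (auto intro: evals.PrimRec_0)
    next
      case 2
      then have "evals (PrimRec g h) (n # zs) u" "evals h (n # u # zs) v"
        using IH PrimRec by blast+
      then show ?thesis unfolding PrimRec \<open>xs = Suc n # zs\<close> by (rule evals.PrimRec_Suc)
    qed
  next
    case (Mu f)
    then have "(recf_code f, v # xs, 0) \<in> set prems"
      "\<forall>m < v. \<exists>u. (recf_code f, m # xs, Suc u) \<in> set prems"
      using derivI.hyps(1) by (auto simp: eval_rule_def)
    then show ?thesis unfolding Mu using IH by (intro evals.Mu) blast+
  qed
qed

lemma evals_code_complete: "evals p xs v \<Longrightarrow> deriv eval_rule (recf_code p, xs, v)"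
proof (induction rule: evals.induct)
  case (Zero xs)
  show ?case by (rule derivI[where prems = "[]"]) (auto simp: eval_rule_def)
next
  case (Succ x)
  show ?case by (rule derivI[where prems = "[]"]) (auto simp: eval_rule_def)
next
  case (Proj i xs)
  show ?case
    by (rule derivI[where prems = "[]"])
      (use Proj in \<open>auto simp: eval_rule_def simp flip: Cons_nth_drop_Suc\<close>)
next
  case (Comp xs gs ys f v)
  let ?prems = "(recf_code f, ys, v) # map (\<lambda>(g, y). (recf_code g, xs, y)) (zip gs ys)"
  have "list_all2 (\<lambda>g y. (g, xs, y) \<in> set ?prems) (map recf_code gs) ys"
    using Comp.IH(1) by (auto simp: list_all2_conv_all_nth set_zip image_iff)
  then have "eval_rule ((recf_code (Comp f gs), xs, v), ?prems)"
    by (simp add: eval_rule_def list_encode_eq) (rule exI[of _ ys], simp)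
  then show ?case
    by (rule derivI) (use Comp.IH in \<open>auto simp: list_all2_conv_all_nth in_set_zip\<close>)
next
  case (PrimRec_0 g xs v h)
  show ?case
    by (rule derivI[where prems = "[(recf_code g, xs, v)]"])
      (use PrimRec_0.IH in \<open>auto simp: eval_rule_def\<close>)
next
  case (PrimRec_Suc g h n xs u v)
  show ?case
    by (rule derivI[where prems = "[(recf_code (PrimRec g h), n # xs, u),
        (recf_code h, n # u # xs, v)]"])
      (use PrimRec_Suc.IH in \<open>auto simp: eval_rule_def\<close>)
next
  case (Mu f n xs)
  \<comment> \<open>The nonzero values at arguments \<open>m < n\<close> are put in the form
    \<open>Suc u\<close> that the coded rule expects.\<close>
  have "\<exists>u. deriv eval_rule (recf_code f, m # xs, Suc u)" if "m < n" for m
    using Mu.IH(2)[OF that] by (auto simp: gr0_conv_Suc)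
  then obtain u where u: "\<And>m. m < n \<Longrightarrow> deriv eval_rule (recf_code f, m # xs, Suc (u m))"
    by metis
  let ?prems = "(recf_code f, n # xs, 0) # map (\<lambda>m. (recf_code f, m # xs, Suc (u m))) [0..<n]"
  have "eval_rule ((recf_code (Mu f), xs, n), ?prems)"
    by (simp add: eval_rule_def image_iff)
  then show ?case
    by (rule derivI) (use Mu.IH u in auto)
qed

lemma evals_code_iff: "evals_code (recf_code p) xs v \<longleftrightarrow> evals p xs v"
  unfolding evals_code_def using evals_code_sound evals_code_complete by blast

text \<open>Post's theorem as a promise problem.\<close>

lemma decide_between_re:
  fixes A B :: "nat \<Rightarrow> bool"
  assumes "re A" "re B"
  shows "\<exists>D. \<forall>c. (A c \<longleftrightarrow> \<not> B c) \<longrightarrow> evals D [c] (if A c then 1 else 0)"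
proof -
  obtain C D where C: "decidable C" "\<And>x. A x \<longleftrightarrow> (\<exists>w :: nat. C (x, w))"
    and D: "decidable D" "\<And>x. B x \<longleftrightarrow> (\<exists>w :: nat. D (x, w))"
    using assms by (elim reE) blast
  \<comment> \<open>\<open>Mu\<close> prepends the search variable, hence the reversed components.
    The function is 0 exactly when \<open>w\<close> certifies at least one side.\<close>
  have "decidable (\<lambda>p. \<not> (C (snd p, fst p) \<or> D (snd p, fst p)))"
    by (intro decidable_not decidable_disj decidable_comp[OF C(1)] decidable_comp[OF D(1)]
        comp_intros)
  then have "computable (\<lambda>p. of_bool (\<not> (C (snd p, fst p) \<or> D (snd p, fst p))) :: nat)"
    unfolding decidable_def .
  then obtain s where s: "\<And>w c. evals s [prod_encode (w, c)] (of_bool (\<not> (C (c, w) \<or> D (c, w))))"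
    unfolding computable_def by fastforce
  obtain d where d: "\<And>c w. evals d [prod_encode (c, w)] (of_bool (C (c, w)))"
    using C(1) unfolding decidable_def computable_def by fastforce
  obtain pair where pair: "\<And>a b. evals pair [a, b] (prod_encode (a, b))"
  proof -
    have "computes 2 (\<lambda>xs. prod_encode (xs ! 0, xs ! 1))"
      by (intro computes_prod_encode computes_Proj) auto
    then obtain p where "\<And>xs. length xs = 2 \<Longrightarrow> evals p xs (prod_encode (xs ! 0, xs ! 1))"
      unfolding computes_def by blast
    from this[of "[_, _]"] show thesis by (intro that[of p]) simp
  qed
  have "evals (Comp d [Comp pair [Proj 0, Mu (Comp s [pair])]]) [c] (if A c then 1 else 0)"
    if promise: "A c \<longleftrightarrow> \<not> B c" for c
  proof -
    let ?g = "\<lambda>w. of_bool (\<not> (C (c, w) \<or> D (c, w))) :: nat"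
    define w where "w = (LEAST w. ?g w = 0)"
    obtain w0 where w0: "?g w0 = 0" using promise C(2)[of c] D(2)[of c] by auto
    have "evals (Mu (Comp s [pair])) [c] w"
      unfolding w_def by (rule evals_Mu[where g = ?g, OF evals_Comp1[OF pair s] w0])
    then have "evals (Comp d [Comp pair [Proj 0, Mu (Comp s [pair])]]) [c] (of_bool (C (c, w)))"
      by (intro evals_Comp1[OF evals_Comp2[OF evals_Proj _ pair] d]) auto
    moreover have "C (c, w) \<or> D (c, w)"
      using LeastI[of "\<lambda>w. ?g w = 0", OF w0] unfolding w_def by simp
    \<comment> \<open>The promise rules out certificates for the other side, so testing
      \<open>C\<close> at the number found gives the answer.\<close>
    with promise C(2)[of c] D(2)[of c] have "C (c, w) \<longleftrightarrow> A c" by blast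
    ultimately show ?thesis by (simp add: of_bool_def)
  qed
  then show ?thesis by blast
qed


section \<open>Finite and infinite reachability sets\<close>

text \<open>Koenig's lemma, run inside the breadth-first edges: along them the distance from
  \<open>a\<close> grows by one at each step, which yields injectivity.\<close>

lemma infinite_path_of_infinite_reach:
  assumes fin: "\<And>x. (a, x) \<in> r\<^sup>* \<Longrightarrow> finite (r `` {x})"
    and inf: "infinite (r\<^sup>* `` {a})"
  shows "\<exists>f :: nat \<Rightarrow> 'a. f 0 = a \<and> (\<forall>i. (f i, f (Suc i)) \<in> r) \<and> inj f"
proof -
  define d where "d y = (LEAST n. (a, y) \<in> r ^^ n)" for y
  have d_le: "d y \<le> n" if "(a, y) \<in> r ^^ n" for y n
    unfolding d_def using that by (rule Least_le)
  have d_path: "(a, y) \<in> r ^^ d y" if "(a, y) \<in> r\<^sup>*" for y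
    unfolding d_def using that by (auto simp: rtrancl_power intro: LeastI)
  \<comment> \<open>Paths along \<open>T\<close> are geodesics, so they never repeat a vertex.\<close>
  define T where "T = {(x, y) \<in> r. (a, x) \<in> r\<^sup>* \<and> d y = Suc (d x)}"
  have "(a, y) \<in> T\<^sup>*" if "(a, y) \<in> r\<^sup>*" "d y = n" for n y
    using that
  proof (induction n arbitrary: y)
    case 0
    then show ?case using d_path[of y] by auto
  next
    case (Suc n)
    then obtain x where x: "(a, x) \<in> r ^^ n" "(x, y) \<in> r"
      using d_path[of y] by auto
    have reach: "(a, x) \<in> r\<^sup>*" using x(1) by (rule relpow_imp_rtrancl)
    \<comment> \<open>The last vertex before \<open>y\<close> on a shortest path is at distance
      exactly \<open>n\<close>: a shorter way to \<open>x\<close> would shorten the way to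
      \<open>y\<close>.\<close>
    have "(a, y) \<in> r ^^ Suc (d x)" using d_path[OF reach] x(2) by auto
    from d_le[OF this] have "d x = n" using d_le[OF x(1)] Suc.prems(2) by simp
    with x(2) reach Suc.prems(2) have "(x, y) \<in> T" by (simp add: T_def)
    with Suc.IH[OF reach \<open>d x = n\<close>] show ?case by simp
  qed
  then have "r\<^sup>* `` {a} \<subseteq> T\<^sup>* `` {a}" by auto
  with inf have "infinite (T\<^sup>* `` {a})" using finite_subset by blast
  moreover have "\<exists>y. ((a, y) \<in> r\<^sup>* \<and> infinite (T\<^sup>* `` {y})) \<and> (x, y) \<in> T"
    if x: "(a, x) \<in> r\<^sup>* \<and> infinite (T\<^sup>* `` {x})" for x
  proof -
    have "T\<^sup>* `` {x} \<subseteq> insert x (\<Union>y\<in>T `` {x}. T\<^sup>* `` {y})"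
      by (auto elim: converse_rtranclE)
    moreover have "finite (T `` {x})"
      using fin[of x] x by (auto intro: rev_finite_subset simp: T_def)
    \<comment> \<open>The descendants of \<open>x\<close> are \<open>x\<close> itself and those of
      its finitely many successors, so some successor has infinitely many.\<close>
    ultimately obtain y where "(x, y) \<in> T" "infinite (T\<^sup>* `` {y})"
      using x by (metis (no_types, lifting) Image_singleton_iff finite_UN finite_insert
          finite_subset)
    with x show ?thesis by (auto simp: T_def intro: rtrancl_into_rtrancl)
  qed
  \<comment> \<open>The invariant of the choice is to be reachable with infinitely many descendants;
    the clause for \<open>i = 0\<close> fixes the start at \<open>a\<close>.\<close>
  ultimately obtain f where f: "f 0 = a" "\<And>i. (f i, f (Suc i)) \<in> T"
    using dependent_nat_choice[of "\<lambda>i x. ((a, x) \<in> r\<^sup>* \<and> infinite (T\<^sup>* `` {x})) \<and> (i = 0 \<longrightarrow> x = a)"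
        "\<lambda>_ x y. (x, y) \<in> T"] by auto
  have "d (f i) = d (f 0) + i" for i
    using f(2) by (induction i) (auto simp: T_def)
  then have "inj f" by (metis add_left_cancel injI)
  with f show ?thesis by (auto simp: T_def)
qed

lemma word_step_in_rtrancl: "word_step S x w y \<Longrightarrow> (x, y) \<in> (step S)\<^sup>*"
  by (induction w arbitrary: x) (auto simp: step_def intro: converse_rtrancl_into_rtrancl)

section \<open>Infinite reachability sets and strict increases\<close>

context
  fixes S :: "('x, 'a) olts"
  assumes olts: "is_olts S"
begin

lemma step_states: "(x, y) \<in> step S \<Longrightarrow> x \<in> states S \<and> y \<in> states S"
  using olts by (auto simp: is_olts_def step_def)

lemma reach_states: "(x, y) \<in> (step S)\<^sup>* \<Longrightarrow> x \<in> states S \<Longrightarrow> y \<in> states S"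
  by (induction rule: rtrancl_induct) (auto dest: step_states)

lemma Post_star_init: "Post_star S (init S) = (step S)\<^sup>* `` {init S}"
  using olts reach_states by (auto simp: Post_star_def is_olts_def)

lemma rtrancl_word_step:
  assumes "(x, y) \<in> (step S)\<^sup>*"
  shows "\<exists>w\<in>lists (alphabet S). word_step S x w y"
  using assms
proof (induction rule: converse_rtrancl_induct)
  case base
  show ?case by (intro bexI[of _ "[]"]) auto
next
  case (step x z)
  then obtain w a where "w \<in> lists (alphabet S)" "word_step S z w y" "(x, a, z) \<in> transitions S"
    by (auto simp: step_def)
  moreover from this(3) have "a \<in> alphabet S" using olts by (auto simp: is_olts_def)
  ultimately show ?case by (intro bexI[of _ "a # w"]) auto
qed

lemma increase_if_infinite_Post_star:
  assumes "finitely_branching S" "branch_wqo S" "antisym (leq S)"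
    and "infinite (Post_star S (init S))"
  shows "\<exists>x y. (init S, x) \<in> (step S)\<^sup>* \<and> (x, y) \<in> (step S)\<^sup>* \<and> (x, y) \<in> less_rel S"
proof -
  have init: "init S \<in> states S" using olts by (simp add: is_olts_def)
  have "finite (step S `` {x})" if "(init S, x) \<in> (step S)\<^sup>*" for x
    using assms(1) reach_states[OF that init]
    by (simp add: finitely_branching_def Post_def Image_singleton)
  from infinite_path_of_infinite_reach[OF this] assms(4)
  obtain f where f: "f 0 = init S" "\<And>i. (f i, f (Suc i)) \<in> step S" "inj f"
    unfolding Post_star_init by blast
  have path: "(f i, f j) \<in> (step S)\<^sup>*" if "i \<le> j" for i j
    using that by (induction rule: dec_induct) (auto intro: rtrancl_into_rtrancl f(2))
  have "wqo_on (range f) (leq S)"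
    using assms(2) f unfolding branch_wqo_def infinite_run_def by blast
  then obtain i j where ij: "i < j" "(f i, f j) \<in> leq S"
    unfolding wqo_on_def by blast
  \<comment> \<open>Injectivity separates the two states; antisymmetry then makes the inequality
    strict.\<close>
  moreover have "f i \<noteq> f j" using f(3) ij(1) by (auto dest: injD)
  ultimately have "(f i, f j) \<in> less_rel S"
    using assms(3) by (auto simp: less_rel_def antisym_def)
  moreover have "(init S, f i) \<in> (step S)\<^sup>*" using path[of 0 i] f(1) by simp
  moreover have "(f i, f j) \<in> (step S)\<^sup>*" using path ij(1) by simp
  ultimately show ?thesis by blast
qed

text \<open>Strict monotonicity repeats one word \<open>w\<close> forever, so the targets of increasing \<open>w\<close>-steps
  have no maximal element.\<close>

lemma infinite_Post_star_if_increase: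
  assumes mono: "strictly_branch_monotone S"
    and "(init S, x) \<in> (step S)\<^sup>*" "(x, y) \<in> (step S)\<^sup>*" "(x, y) \<in> less_rel S"
  shows "infinite (Post_star S (init S))"
proof
  assume fin: "finite (Post_star S (init S))"
  have init: "init S \<in> states S" using olts by (simp add: is_olts_def)
  obtain w where w: "w \<in> lists (alphabet S)" "word_step S x w y"
    using rtrancl_word_step[OF assms(3)] by blast
  define M where "M = {z. (init S, z) \<in> (step S)\<^sup>* \<and>
    (\<exists>u\<in>states S. word_step S u w z \<and> (u, z) \<in> less_rel S)}"
  have "finite M"
    by (rule finite_subset[OF _ fin]) (auto simp: M_def Post_star_init)
  have "y \<in> M"
    using assms(2-4) w(2) reach_states[OF assms(2) init] by (auto simp: M_def)
  \<comment> \<open>The increase from \<open>u\<close> to \<open>z\<close> along \<open>w\<close> is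
    repeated from \<open>z\<close> with the same word, so the new target lies in \<open>M\<close>
    again.\<close>
  have up: "\<exists>z'\<in>M. (z, z') \<in> less_rel S" if "z \<in> M" for z
  proof -
    from that obtain u where u: "(init S, z) \<in> (step S)\<^sup>*" "u \<in> states S" "word_step S u w z"
      "(u, z) \<in> less_rel S" by (auto simp: M_def)
    have "z \<in> states S" using reach_states[OF u(1) init] .
    with mono u w(1) obtain z' where z': "word_step S z w z'" "(z, z') \<in> less_rel S"
      unfolding strictly_branch_monotone_def by blast
    then have "z' \<in> M"
      using u(1) \<open>z \<in> states S\<close> word_step_in_rtrancl[OF z'(1)] by (auto simp: M_def)
    with z' show ?thesis by blast
  qed
  \<comment> \<open>A transitive irreflexive relation on the finite nonempty set \<open>M\<close>
    has a maximal element, against \<open>up\<close>.\<close>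
  let ?r = "Restr (less_rel S) M"
  have "trans (leq S)" using olts by (simp add: is_olts_def preorder_on_def)
  then have "trans ?r" by (auto simp: trans_def less_rel_def)
  then have "acyclic ?r" by (intro acyclicI) (auto simp: less_rel_def)
  then have "wf (?r\<inverse>)"
    using \<open>finite M\<close> by (intro finite_acyclic_wf_converse) auto
  from wfE_min[OF this \<open>y \<in> M\<close>] obtain z
    where "z \<in> M" "\<And>z'. (z', z) \<in> ?r\<inverse> \<Longrightarrow> z' \<notin> M" by blast
  with up show False by blast
qed

end


section \<open>The decision procedure\<close>

definition post_code :: "nat \<Rightarrow> nat \<Rightarrow> nat \<Rightarrow> bool" where
  "post_code p x y \<longleftrightarrow> (\<exists>ys. evals_code p [x] (list_encode ys) \<and> y \<in> set ys)"

lemma re_post_code [re_intros]: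
  assumes "computable f" "computable g" "computable h"
  shows "re (\<lambda>x. post_code (f x) (g x) (h x))"
proof -
  have "re (\<lambda>p. post_code (fst (fst p)) (snd (fst p)) (snd p))"
    unfolding post_code_def by (intro re_intros comp_intros)
  then show ?thesis by (rule re_comp3) (intro assms)+
qed

text \<open>The certificate \<open>xs\<close> is a list of numbers closed under the program
  \<open>p\<close>. It may exceed the reachable set and even contain numbers that code no
  state.\<close>

definition bounded_code :: "nat \<Rightarrow> bool" where
  "bounded_code c \<longleftrightarrow> (\<exists>l t p i xs. c = list_encode [l, t, p, i] \<and> i \<in> set xs \<and>
    (\<forall>x\<in>set xs. \<exists>ys. evals_code p [x] (list_encode ys) \<and> (\<forall>y\<in>set ys. y \<in> set xs)))"

text \<open>Strictness asks for a halting answer 0 on the reversed pair rather than for the absence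
  of answer 1, which keeps the predicate enumerable.\<close>

definition unbounded_code :: "nat \<Rightarrow> bool" where
  "unbounded_code c \<longleftrightarrow> (\<exists>l t p i x y. c = list_encode [l, t, p, i] \<and>
    (post_code p)\<^sup>*\<^sup>* i x \<and> (post_code p)\<^sup>*\<^sup>* x y \<and>
    evals_code l [x, y] 1 \<and> evals_code l [y, x] 0)"

lemma re_bounded_code: "re bounded_code"
  unfolding bounded_code_def by (intro re_intros comp_intros)

lemma re_unbounded_code: "re unbounded_code"
  unfolding unbounded_code_def by (intro re_intros comp_intros)

section \<open>Correctness of the certificates on a presentation\<close>

context
  fixes S :: "('x, 'a) olts" and enc letters P
  assumes olts: "is_olts S" and pres: "branch_effectively_presents enc letters P S"
begin

lemma init_code: "init_code P = enc (init S)"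
  and inj_enc: "inj_on enc (states S)"
  using pres by (auto simp: branch_effectively_presents_def effectively_presents_def)

lemma init_in_states: "init S \<in> states S"
  using olts by (simp add: is_olts_def)

lemma leq_code:
  assumes "x \<in> states S" "y \<in> states S"
  shows "evals_code (recf_code (leq_prog P)) [enc x, enc y] v \<longleftrightarrow>
    v = (if (x, y) \<in> leq S then 1 else 0)"
proof -
  have "evals (leq_prog P) [enc x, enc y] (if (x, y) \<in> leq S then 1 else 0)"
    using pres assms by (auto simp: branch_effectively_presents_def effectively_presents_def)
  then show ?thesis unfolding evals_code_iff using evals_deterministic by blast
qed

text \<open>Determinism and injectivity of \<open>list_encode\<close> leave one possible output, so
  any list that a search comes upon is this enumeration of the successors.\<close>

lemma post_prog_code:
  assumes "x \<in> states S"
  obtains ys where "set ys = Post S x"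
    "\<And>zs. evals_code (recf_code (post_prog P)) [enc x] (list_encode zs) \<longleftrightarrow> zs = map enc ys"
proof -
  obtain ys where ys: "set ys = Post S x"
    "evals (post_prog P) [enc x] (list_encode (map enc ys))"
    using pres assms by (auto simp: branch_effectively_presents_def)
  show thesis
    by (rule that[OF ys(1)])
      (use ys(2) in \<open>auto simp: evals_code_iff list_encode_eq dest: evals_deterministic\<close>)
qed

lemma post_code_iff:
  assumes "x \<in> states S"
  shows "post_code (recf_code (post_prog P)) (enc x) n \<longleftrightarrow> (\<exists>y. (x, y) \<in> step S \<and> n = enc y)"
proof -
  obtain ys where "set ys = Post S x"
    "\<And>zs. evals_code (recf_code (post_prog P)) [enc x] (list_encode zs) \<longleftrightarrow> zs = map enc ys"
    using post_prog_code[OF assms] by blast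
  then show ?thesis by (auto simp: post_code_def Post_def)
qed

text \<open>Paths of codes that start at a state stay among codes of states, where the output of the
  program is known.\<close>

lemma reach_code_iff:
  assumes "x \<in> states S"
  shows "(post_code (recf_code (post_prog P)))\<^sup>*\<^sup>* (enc x) n \<longleftrightarrow>
    (\<exists>y. (x, y) \<in> (step S)\<^sup>* \<and> n = enc y)"
proof
  assume "(post_code (recf_code (post_prog P)))\<^sup>*\<^sup>* (enc x) n"
  then show "\<exists>y. (x, y) \<in> (step S)\<^sup>* \<and> n = enc y"
  proof (induction rule: rtranclp_induct)
    case (step m n)
    then obtain y where y: "(x, y) \<in> (step S)\<^sup>*" "m = enc y" by blast
    with step.hyps(2) post_code_iff[OF reach_states[OF olts y(1) assms]] show ?case
      by (auto intro: rtrancl_into_rtrancl)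
  qed blast
next
  assume "\<exists>y. (x, y) \<in> (step S)\<^sup>* \<and> n = enc y"
  then obtain y where "(x, y) \<in> (step S)\<^sup>*" "n = enc y" by blast
  from this(1) show "(post_code (recf_code (post_prog P)))\<^sup>*\<^sup>* (enc x) n"
    unfolding \<open>n = enc y\<close>
  proof (induction rule: rtrancl_induct)
    case (step y z)
    then have "post_code (recf_code (post_prog P)) (enc y) (enc z)"
      using post_code_iff reach_states[OF olts step.hyps(1) assms] by blast
    with step.IH show ?case by (rule rtranclp.rtrancl_into_rtrancl)
  qed simp
qed

lemma unbounded_code_iff:
  "unbounded_code (presentation_code P) \<longleftrightarrow>
    (\<exists>x y. (init S, x) \<in> (step S)\<^sup>* \<and> (x, y) \<in> (step S)\<^sup>* \<and> (x, y) \<in> less_rel S)"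
proof -
  let ?post = "post_code (recf_code (post_prog P))" and ?leq = "recf_code (leq_prog P)"
  have "unbounded_code (presentation_code P) \<longleftrightarrow> (\<exists>m n.
      ?post\<^sup>*\<^sup>* (enc (init S)) m \<and> ?post\<^sup>*\<^sup>* m n \<and> evals_code ?leq [m, n] 1 \<and> evals_code ?leq [n, m] 0)"
    by (simp add: unbounded_code_def presentation_code_def list_encode_eq init_code
        del: list_encode.simps)
  also have "\<dots> \<longleftrightarrow> (\<exists>x. (init S, x) \<in> (step S)\<^sup>* \<and> (\<exists>n. ?post\<^sup>*\<^sup>* (enc x) n \<and>
      evals_code ?leq [enc x, n] 1 \<and> evals_code ?leq [n, enc x] 0))"
    unfolding reach_code_iff[OF init_in_states] by blast
  also have "\<dots> \<longleftrightarrow> (\<exists>x. (init S, x) \<in> (step S)\<^sup>* \<and> (\<exists>y. (x, y) \<in> (step S)\<^sup>* \<and> (x, y) \<in> less_rel S))"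
  \<comment> \<open>The congruence supplies reachability of \<open>x\<close>, hence that
    \<open>x\<close> is a state, as \<open>leq_code\<close> requires.\<close>
  proof (intro ex_cong1 conj_cong refl)
    fix x
    assume "(init S, x) \<in> (step S)\<^sup>*"
    then have x: "x \<in> states S" using reach_states[OF olts] init_in_states by blast
    have "(evals_code ?leq [enc x, enc y] 1 \<and> evals_code ?leq [enc y, enc x] 0) \<longleftrightarrow>
        (x, y) \<in> less_rel S" if "(x, y) \<in> (step S)\<^sup>*" for y
      using x reach_states[OF olts that x] by (auto simp: leq_code less_rel_def)
    then show "(\<exists>n. ?post\<^sup>*\<^sup>* (enc x) n \<and> evals_code ?leq [enc x, n] 1 \<and>
        evals_code ?leq [n, enc x] 0) \<longleftrightarrow> (\<exists>y. (x, y) \<in> (step S)\<^sup>* \<and> (x, y) \<in> less_rel S)"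
      unfolding reach_code_iff[OF x] by blast
  qed
  finally show ?thesis by blast
qed

lemma bounded_code_iff:
  "bounded_code (presentation_code P) \<longleftrightarrow> finite (Post_star S (init S))"
proof -
  let ?post = "recf_code (post_prog P)"
  have "bounded_code (presentation_code P) \<longleftrightarrow> (\<exists>xs. enc (init S) \<in> set xs \<and>
    (\<forall>x\<in>set xs. \<exists>ys. evals_code ?post [x] (list_encode ys) \<and> set ys \<subseteq> set xs))"
    by (simp add: bounded_code_def presentation_code_def list_encode_eq init_code subset_eq
        del: list_encode.simps)
  also have "\<dots> \<longleftrightarrow> finite (Post_star S (init S))"
  proof
    assume "\<exists>xs. enc (init S) \<in> set xs \<and>
      (\<forall>x\<in>set xs. \<exists>ys. evals_code ?post [x] (list_encode ys) \<and> set ys \<subseteq> set xs)"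
    then obtain xs where xs: "enc (init S) \<in> set xs"
      "\<And>x. x \<in> set xs \<Longrightarrow> \<exists>ys. evals_code ?post [x] (list_encode ys) \<and> set ys \<subseteq> set xs"
      by blast
    \<comment> \<open>Induction along the path: by determinism the list found for
      \<open>enc y\<close> contains the codes of all successors of \<open>y\<close>.\<close>
    have "enc y \<in> set xs" if "(init S, y) \<in> (step S)\<^sup>*" for y
      using that
    proof (induction rule: rtrancl_induct)
      case (step y z)
      obtain ys where ys: "set ys = Post S y"
        "\<And>zs. evals_code ?post [enc y] (list_encode zs) \<longleftrightarrow> zs = map enc ys"
        using post_prog_code reach_states[OF olts step.hyps(1) init_in_states] by blast
      have "z \<in> set ys" using step.hyps(2) by (simp add: ys(1) Post_def)
      with xs(2)[OF step.IH] ys(2) show ?case by auto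
    qed (use xs(1) in simp)
    then have "enc ` Post_star S (init S) \<subseteq> set xs"
      by (auto simp: Post_star_def)
    then have "finite (enc ` Post_star S (init S))"
      using finite_subset by blast
    moreover have "inj_on enc (Post_star S (init S))"
      using inj_enc by (rule inj_on_subset) (auto simp: Post_star_def)
    ultimately show "finite (Post_star S (init S))"
      by (rule finite_imageD)
  next
    assume "finite (Post_star S (init S))"
    then obtain us where us: "set us = Post_star S (init S)"
      using finite_list by blast
    \<comment> \<open>Conversely, the codes of all reachable states form a certificate.\<close>
    have "\<exists>ys. evals_code ?post [x] (list_encode ys) \<and> set ys \<subseteq> set (map enc us)"
      if "x \<in> set (map enc us)" for x
    proof -
      from that obtain u where u: "x = enc u" "u \<in> states S" "(init S, u) \<in> (step S)\<^sup>*"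
        by (auto simp: us Post_star_def)
      obtain ys where ys: "set ys = Post S u"
        "\<And>zs. evals_code ?post [enc u] (list_encode zs) \<longleftrightarrow> zs = map enc ys"
        using post_prog_code[OF u(2)] by blast
      have "Post S u \<subseteq> Post_star S (init S)"
        unfolding Post_star_init[OF olts] Post_def
        using u(3) by (auto intro: rtrancl_into_rtrancl)
      with u(1) ys show ?thesis by (intro exI[of _ "map enc ys"]) (auto simp: us)
    qed
    moreover have "enc (init S) \<in> set (map enc us)"
      by (simp add: us Post_star_init[OF olts])
    ultimately show "\<exists>xs. enc (init S) \<in> set xs \<and>
      (\<forall>x\<in>set xs. \<exists>ys. evals_code ?post [x] (list_encode ys) \<and> set ys \<subseteq> set xs)"
      by blast
  qed
  finally show ?thesis .
qed

end

theorem theorem3p13: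
  shows "\<exists>D :: recf. \<forall>(S :: ('x, 'a) olts) enc letters P.
    branch_WSTS S \<and> strictly_branch_monotone S \<and>
    partial_order_on (states S) (leq S) \<and>
    branch_effectively_presents enc letters P S \<longrightarrow>
    evals D [presentation_code P] (if finite (Post_star S (init S)) then 1 else 0)"
proof -
  \<comment> \<open>\<open>D\<close> is fixed before any system is mentioned, so one program serves
    all presentations.\<close>
  obtain D where D: "\<And>c. (bounded_code c \<longleftrightarrow> \<not> unbounded_code c) \<Longrightarrow>
      evals D [c] (if bounded_code c then 1 else 0)"
    using decide_between_re[OF re_bounded_code re_unbounded_code] by blast
  have "evals D [presentation_code P] (if finite (Post_star S (init S)) then 1 else 0)"
    if "branch_WSTS S" "strictly_branch_monotone S" "partial_order_on (states S) (leq S)"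
      "branch_effectively_presents enc letters P S"
    for S :: "('x, 'a) olts" and enc letters P
  proof -
    have olts: "is_olts S" and "finitely_branching S" "branch_wqo S"
      using that(1) by (auto simp: branch_WSTS_def)
    moreover have "antisym (leq S)" using that(3) by (simp add: partial_order_on_def)
    \<comment> \<open>With \<open>bounded_code_iff\<close> this makes the two predicates
      complementary on the given presentation, which is the promise that \<open>D\<close>
      needs.\<close>
    ultimately have "unbounded_code (presentation_code P) \<longleftrightarrow> infinite (Post_star S (init S))"
      unfolding unbounded_code_iff[OF olts that(4)]
      using increase_if_infinite_Post_star[OF olts]
        infinite_Post_star_if_increase[OF olts that(2)] by blast
    with D[of "presentation_code P"] show ?thesis
      by (simp add: bounded_code_iff[OF olts that(4)])
  qed
  then show ?thesis by blast
qed

end
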